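(* Let $G=(V,E,w,\mu)$ be a weighted graph with $|V|\geq3$ (and zero potential). Then for every $1\le k\le |V|$, $$\rho_k(G)\geq(\tau_{\min}-\eta)\left(1-\frac1k\right),$$ where $\tau_{\min}=\min_{i\in V} d(i)/\mu_i$.
   Context: $G$ is a finite simple graph without isolated vertices, $V=\{1,\dots,n\}$, edge weights $w:E\to\mathbb{R}_{>0}$, vertex measure $\mu:V\to\mathbb{R}_{>0}$, $d(i)=\sum_{j\sim i}w_{ij}$. Let $A$ be the weighted adjacency matrix and $M=\mathrm{diag}(\mu_i)$. The eigenvalues of the normalized adjacency matrix $\mathcal{A}=M^{-1}A$ are $\eta_n\leq\cdots\leq\eta_2\leq\eta_1$, and $\eta=\max\{|\eta_2|,|\eta_n|\}$. For $\emptyset\neq S\subset V$, $\Phi_G(S)=\frac{\sum_{i\in S,j\notin S}w_{ij}}{\sum_{i\in S}\mu_i}$, and $\rho_k(G)=\min\max_{1\leq i\leq k}\Phi_G(A_i)$ over all $k$-tuples of nonempty pairwise disjoint subsets $A_1,\dots,A_k$ of $V$. *)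

theory Defs
  imports
    Complex_Main
    "HOL-Library.FuncSet"
    "HOL-Library.Disjoint_Sets"
    "Jordan_Normal_Form.Char_Poly"
begin

text \<open>
  Finite simple graphs without isolated vertices, with positive edge weights and a positive
  vertex measure. The vertex set is \<open>{..<n}\<close> rather than \<open>{1..n}\<close>, to match the index range of
  \<open>n \<times> n\<close> matrices. An edge is a two-element set of vertices, so that
  loops are excluded and \<open>w {i, j} = w {j, i}\<close> is automatic; the values of \<open>w\<close> outside \<open>E\<close> and
  of \<open>\<mu>\<close> outside \<open>{..<n}\<close> are irrelevant.
\<close>

locale weighted_graph =
  fixes n :: nat
    and E :: "nat set set"
    and w :: "nat set \<Rightarrow> real"
    and \<mu> :: "nat \<Rightarrow> real"
  assumes edges: "E \<subseteq> {{i, j} | i j. i < n \<and> j < n \<and> i \<noteq> j}"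
    and no_isolated: "\<And>i. i < n \<Longrightarrow> \<exists>j. {i, j} \<in> E"
    and weight_pos: "\<And>e. e \<in> E \<Longrightarrow> 0 < w e"
    and measure_pos: "\<And>i. i < n \<Longrightarrow> 0 < \<mu> i"

definition edge_weight :: "nat set set \<Rightarrow> (nat set \<Rightarrow> real) \<Rightarrow> nat \<Rightarrow> nat \<Rightarrow> real" where
  "edge_weight E w i j = (if {i, j} \<in> E then w {i, j} else 0)"

definition weighted_degree :: "nat \<Rightarrow> nat set set \<Rightarrow> (nat set \<Rightarrow> real) \<Rightarrow> nat \<Rightarrow> real" where
  "weighted_degree n E w i = (\<Sum>j \<in> {j. j < n \<and> {i, j} \<in> E}. w {i, j})"

definition tau_min ::
    "nat \<Rightarrow> nat set set \<Rightarrow> (nat set \<Rightarrow> real) \<Rightarrow> (nat \<Rightarrow> real) \<Rightarrow> real" where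
  "tau_min n E w \<mu> = (MIN i\<in>{..<n}. weighted_degree n E w i / \<mu> i)"

definition adjacency_matrix :: "nat \<Rightarrow> nat set set \<Rightarrow> (nat set \<Rightarrow> real) \<Rightarrow> real mat" where
  "adjacency_matrix n E w = mat n n (\<lambda>(i, j). edge_weight E w i j)"

text \<open>The matrix \<open>M\<inverse> A\<close> with \<open>M = diag (\<mu>\<^sub>i)\<close>; the inverse of \<open>M\<close> is \<open>diag (1 / \<mu>\<^sub>i)\<close>.\<close>

definition normalized_adjacency_matrix ::
    "nat \<Rightarrow> nat set set \<Rightarrow> (nat set \<Rightarrow> real) \<Rightarrow> (nat \<Rightarrow> real) \<Rightarrow> real mat" where
  "normalized_adjacency_matrix n E w \<mu> = mat_diag n (\<lambda>i. 1 / \<mu> i) * adjacency_matrix n E w"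

text \<open>
  The real eigenvalues of a real matrix in decreasing order, repeated according to their
  (algebraic) multiplicity. The normalized adjacency matrix is self-adjoint for the inner product
  weighted by \<open>\<mu>\<close>, so for it the list comprises all \<open>n\<close> eigenvalues, and algebraic and geometric
  multiplicities agree.
\<close>

definition eigenvalues_decreasing :: "real mat \<Rightarrow> real list" where
  "eigenvalues_decreasing B = rev (sorted_list_of_multiset (proots (char_poly B)))"

text \<open>The indices \<open>k = 1, \<dots>, n\<close> are one-based: \<open>nth_eigenvalue B 1\<close> is the largest eigenvalue.\<close>

definition nth_eigenvalue :: "real mat \<Rightarrow> nat \<Rightarrow> real" where
  "nth_eigenvalue B k = eigenvalues_decreasing B ! (k - 1)"

definition eta ::
    "nat \<Rightarrow> nat set set \<Rightarrow> (nat set \<Rightarrow> real) \<Rightarrow> (nat \<Rightarrow> real) \<Rightarrow> real" where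
  "eta n E w \<mu> =
    max \<bar>nth_eigenvalue (normalized_adjacency_matrix n E w \<mu>) 2\<bar>
        \<bar>nth_eigenvalue (normalized_adjacency_matrix n E w \<mu>) n\<bar>"

definition Phi ::
    "nat \<Rightarrow> nat set set \<Rightarrow> (nat set \<Rightarrow> real) \<Rightarrow> (nat \<Rightarrow> real) \<Rightarrow> nat set \<Rightarrow> real" where
  "Phi n E w \<mu> S =
    (\<Sum>i\<in>S. \<Sum>j\<in>{..<n} - S. edge_weight E w i j) / (\<Sum>i\<in>S. \<mu> i)"

text \<open>
  Using extensional functions for the tuples makes this set finite, so that the minimum
  below is a genuine one for \<open>1 \<le> k \<le> n\<close>.
\<close>

definition disjoint_tuples :: "nat \<Rightarrow> nat \<Rightarrow> (nat \<Rightarrow> nat set) set" where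
  "disjoint_tuples n k =
    {A \<in> {1..k} \<rightarrow>\<^sub>E (Pow {..<n} - {{}}). disjoint_family_on A {1..k}}"

definition rho ::
    "nat \<Rightarrow> nat set set \<Rightarrow> (nat set \<Rightarrow> real) \<Rightarrow> (nat \<Rightarrow> real) \<Rightarrow> nat \<Rightarrow> real" where
  "rho n E w \<mu> k = (MIN A\<in>disjoint_tuples n k. MAX i\<in>{1..k}. Phi n E w \<mu> (A i))"

end

(*
  For f = 1_S the Dirichlet form (1/2) sum_{i,j} w_ij (f_i - f_j)^2 = <f, (D - A) f> is the weight
  of the boundary of S. Since D >= tau_min M, and the Rayleigh quotient of M^{-1} A is at most eta_2
  on a hyperplane, this form satisfies a Poincare inequality with constant tau_min - eta_2, which
  bounds Phi(S) below by (tau_min - eta_2) (1 - mu(S) / mu(V)) when tau_min > eta_2. Among k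
  disjoint sets, one has measure at most mu(V) / k. If tau_min <= eta there is nothing to prove.
*)

theory Submission
  imports Defs "Jordan_Normal_Form.Jordan_Normal_Form_Existence" "HOL-Combinatorics.List_Permutation"
begin

section \<open>Matrices that are self-adjoint for a weighted inner product\<close>

text \<open>Vectors are functions on \<open>nat\<close> of which only the values below
  \<open>n\<close> count; \<open>weighted_inner_cong\<close> makes this usable.\<close>

definition weighted_inner :: "nat \<Rightarrow> (nat \<Rightarrow> real) \<Rightarrow> (nat \<Rightarrow> real) \<Rightarrow> (nat \<Rightarrow> real) \<Rightarrow> real" where
  "weighted_inner n \<mu> x y = (\<Sum>i<n. \<mu> i * x i * y i)"

definition mat_apply :: "nat \<Rightarrow> real mat \<Rightarrow> (nat \<Rightarrow> real) \<Rightarrow> nat \<Rightarrow> real" where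
  "mat_apply n B x i = (\<Sum>j<n. B $$ (i, j) * x j)"

lemma weighted_inner_commute: "weighted_inner n \<mu> x y = weighted_inner n \<mu> y x"
  unfolding weighted_inner_def by (simp add: algebra_simps)

lemma weighted_inner_add:
  "weighted_inner n \<mu> x (\<lambda>i. a * y i + b * z i) = a * weighted_inner n \<mu> x y + b * weighted_inner n \<mu> x z"
  unfolding weighted_inner_def by (simp add: algebra_simps sum.distrib sum_distrib_left)

lemma weighted_inner_cong:
  "(\<And>i. i < n \<Longrightarrow> x i = x' i) \<Longrightarrow> (\<And>i. i < n \<Longrightarrow> y i = y' i) \<Longrightarrow>
    weighted_inner n \<mu> x y = weighted_inner n \<mu> x' y'"
  unfolding weighted_inner_def by (intro sum.cong) auto

lemma weighted_inner_scale:
  "weighted_inner n \<mu> x (\<lambda>i. a * y i) = a * weighted_inner n \<mu> x y"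
  using weighted_inner_add[of n \<mu> x a y 0 y] by simp

lemma weighted_inner_sum:
  "weighted_inner n \<mu> (\<lambda>i. \<Sum>j<m. a j * P i j) (\<lambda>i. \<Sum>l<m. b l * P i l)
    = (\<Sum>j<m. \<Sum>l<m. a j * b l * weighted_inner n \<mu> (\<lambda>i. P i j) (\<lambda>i. P i l))"
proof -
  have "weighted_inner n \<mu> (\<lambda>i. \<Sum>j<m. a j * P i j) (\<lambda>i. \<Sum>l<m. b l * P i l)
      = (\<Sum>i<n. \<Sum>j<m. \<Sum>l<m. \<mu> i * (a j * P i j) * (b l * P i l))"
    unfolding weighted_inner_def by (simp only: mult.assoc sum_product) (simp only: sum_distrib_left)
  also have "\<dots> = (\<Sum>i<n. \<Sum>j<m. \<Sum>l<m. a j * b l * (\<mu> i * P i j * P i l))"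
    by (intro sum.cong refl) simp
  also have "\<dots> = (\<Sum>j<m. \<Sum>i<n. \<Sum>l<m. a j * b l * (\<mu> i * P i j * P i l))"
    by (rule sum.swap)
  also have "\<dots> = (\<Sum>j<m. \<Sum>l<m. \<Sum>i<n. a j * b l * (\<mu> i * P i j * P i l))"
    by (intro sum.cong refl sum.swap)
  also have "\<dots> = (\<Sum>j<m. \<Sum>l<m. a j * b l * weighted_inner n \<mu> (\<lambda>i. P i j) (\<lambda>i. P i l))"
    unfolding weighted_inner_def sum_distrib_left ..
  finally show ?thesis .
qed

section \<open>Jordan matrices and roots of split polynomials\<close>

text \<open>Induction over the blocks: if an index lies in the first block, that block decides the
  entry; otherwise both indices shift by its size. \<open>eigenbasis\<close> reads its chain
  relation off the conclusion.\<close>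

lemma jordan_matrix_nonzero_entry:
  assumes "i < sum_list (map fst n_as)" "j < sum_list (map fst n_as)"
    and "jordan_matrix n_as $$ (i, j) \<noteq> 0" and "i \<noteq> j"
  shows "j = Suc i \<and> jordan_matrix n_as $$ (i, j) = 1
    \<and> jordan_matrix n_as $$ (i, i) = jordan_matrix n_as $$ (j, j)"
  using assms
proof (induction n_as arbitrary: i j)
  case (Cons na n_as)
  obtain m a where na: "na = (m, a)" by force
  let ?s = "sum_list (map fst n_as)"
  show ?case
  proof (cases "i < m \<or> j < m")
    case True
    then show ?thesis
      using Cons.prems unfolding na jordan_matrix_Cons by (auto split: if_splits)
  next
    case False
    then have "i - m < ?s" "j - m < ?s" using Cons.prems na by auto
    \<comment> \<open>The conclusion also compares the diagonal entries at \<open>i\<close> and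
      \<open>j\<close>, so the shift is shown for all four index pairs.\<close>
    moreover have "jordan_matrix (na # n_as) $$ (i', j') = jordan_matrix n_as $$ (i' - m, j' - m)"
      if "i' \<in> {i, j}" "j' \<in> {i, j}" for i' j'
      using that False Cons.prems(1,2) unfolding na jordan_matrix_Cons by auto
    moreover have "i - m \<noteq> j - m" using False Cons.prems(4) by linarith
    ultimately show ?thesis
      using Cons.IH[of "i - m" "j - m"] Cons.prems(3) False by auto
  qed
qed simp

text \<open>Links a split characteristic polynomial to the root multiset that
  \<open>eigenvalues_decreasing\<close> sorts.\<close>

lemma proots_linear_factors:
  fixes as :: "'a :: idom list"
  shows "proots (\<Prod>a\<leftarrow>as. [:- a, 1:]) = mset as"
proof (induction as)
  case (Cons a as)
  have "(\<Prod>a\<leftarrow>as. [:- a, 1:]) \<noteq> 0" by auto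
  then show ?case
    using Cons proots_mult[of "[:- a, 1:]" "\<Prod>a\<leftarrow>as. [:- a, 1:]"] by (simp del: mult_pCons_left)
qed simp

section \<open>Weighted self-adjointness and real spectrum\<close>

locale weighted_self_adjoint =
  fixes n :: nat and \<mu> :: "nat \<Rightarrow> real" and B :: "real mat"
  assumes carrier: "B \<in> carrier_mat n n"
    and pos: "\<And>i. i < n \<Longrightarrow> 0 < \<mu> i"
    and balanced: "\<And>i j. i < n \<Longrightarrow> j < n \<Longrightarrow> \<mu> i * B $$ (i, j) = \<mu> j * B $$ (j, i)"
begin

abbreviation ip (infix "\<star>" 70) where "x \<star> y \<equiv> weighted_inner n \<mu> x y"

lemma ip_self_nonneg: "0 \<le> x \<star> x"
  unfolding weighted_inner_def by (intro sum_nonneg) (simp add: mult.assoc less_imp_le[OF pos])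

lemma ip_self_eq_0:
  assumes "x \<star> x = 0" "i < n" shows "x i = 0"
proof -
  have "\<mu> i * x i * x i = 0"
    using assms(1) unfolding weighted_inner_def
    by (subst (asm) sum_nonneg_eq_0_iff)
       (use assms(2) pos in \<open>auto simp: mult.assoc less_imp_le\<close>)
  then show ?thesis using pos[OF assms(2)] by simp
qed

lemma self_adjoint: "mat_apply n B x \<star> y = x \<star> mat_apply n B y"
proof -
  have "mat_apply n B x \<star> y = (\<Sum>i<n. \<Sum>j<n. (\<mu> i * B $$ (i, j)) * x j * y i)"
    unfolding weighted_inner_def mat_apply_def
    by (simp add: sum_distrib_left sum_distrib_right algebra_simps)
  also have "\<dots> = (\<Sum>i<n. \<Sum>j<n. (\<mu> j * B $$ (j, i)) * x j * y i)"
    using balanced by (intro sum.cong refl) auto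
  also have "\<dots> = (\<Sum>j<n. \<Sum>i<n. (\<mu> j * B $$ (j, i)) * x j * y i)"
    by (rule sum.swap)
  also have "\<dots> = x \<star> mat_apply n B y"
    unfolding weighted_inner_def mat_apply_def
    by (simp add: sum_distrib_left algebra_simps)
  finally show ?thesis .
qed

text \<open>The form \<open>q\<close> of an eigenvector \<open>v\<close> is real because its
  coefficients \<open>\<mu> i * B $$ (i, j)\<close> are real and symmetric; it also equals
  \<open>a\<close> times the positive squared norm \<open>r\<close>.\<close>

lemma complex_eigenvalue_real:
  assumes "eigenvalue (map_mat complex_of_real B) a"
  shows "a \<in> \<real>"
proof -
  obtain v where v: "v \<in> carrier_vec n" "v \<noteq> 0\<^sub>v n" "map_mat complex_of_real B *\<^sub>v v = a \<cdot>\<^sub>v v"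
    using assms carrier unfolding eigenvalue_def eigenvector_def by auto
  have ev: "(\<Sum>j<n. of_real (B $$ (i, j)) * v $ j) = a * v $ i" if "i < n" for i
  proof -
    have "(map_mat complex_of_real B *\<^sub>v v) $ i = (a \<cdot>\<^sub>v v) $ i" using v(3) by simp
    then show ?thesis
      using that v(1) carrier by (simp add: scalar_prod_def lessThan_atLeast0)
  qed
  define q where "q = (\<Sum>i<n. \<Sum>j<n. of_real (\<mu> i * B $$ (i, j)) * (cnj (v $ i) * v $ j))"
  define r where "r = (\<Sum>i<n. \<mu> i * (cmod (v $ i))\<^sup>2)"
  have "q = (\<Sum>i<n. of_real (\<mu> i) * cnj (v $ i) * (\<Sum>j<n. of_real (B $$ (i, j)) * v $ j))"
    unfolding q_def by (simp add: sum_distrib_left algebra_simps)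
  also have "\<dots> = (\<Sum>i<n. of_real (\<mu> i) * cnj (v $ i) * (a * v $ i))"
    using ev by simp
  also have "\<dots> = a * of_real r"
    unfolding r_def sum_distrib_left of_real_sum
    by (intro sum.cong refl) (simp only: of_real_mult complex_norm_square ac_simps)
  finally have q: "q = a * of_real r" .
  have "cnj q = (\<Sum>i<n. \<Sum>j<n. of_real (\<mu> j * B $$ (j, i)) * (v $ i * cnj (v $ j)))"
    unfolding q_def cnj_sum using balanced by (intro sum.cong refl) simp
  also have "\<dots> = q"
    unfolding q_def by (subst sum.swap) (simp add: algebra_simps)
  finally have "q \<in> \<real>" by (simp add: Reals_cnj_iff)
  have "r > 0"
  proof -
    obtain i where i: "i < n" "v $ i \<noteq> 0" using v(1,2) by (metis carrier_vecD eq_vecI index_zero_vec)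
    show ?thesis unfolding r_def
      by (rule sum_pos2[of _ i]) (use i pos in \<open>auto simp: less_imp_le\<close>)
  qed
  then have "a = q / of_real r" using q by simp
  then show ?thesis using \<open>q \<in> \<real>\<close> by simp
qed

text \<open>The factorization over the complex numbers has only real roots, and real polynomials
  embed injectively into complex ones.\<close>

lemma char_poly_splits: "\<exists>as. char_poly B = (\<Prod>a\<leftarrow>as. [:- a, 1:])"
proof -
  interpret map_poly_of_real: map_poly_inj_comm_ring_hom complex_of_real ..
  let ?C = "map_mat complex_of_real B"
  have C: "?C \<in> carrier_mat n n" using carrier by simp
  obtain cs where cs: "char_poly ?C = (\<Prod>c\<leftarrow>cs. [:- c, 1:])"
    using char_poly_factorized[OF C] by blast
  have "c \<in> \<real>" if "c \<in> set cs" for c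
    using complex_eigenvalue_real eigenvalue_root_char_poly[OF C] linear_poly_root[OF that] cs by simp
  then have Re: "map complex_of_real (map Re cs) = cs"
    by (auto intro!: map_idI)
  have "map_poly complex_of_real (char_poly B) = (\<Prod>c\<leftarrow>map complex_of_real (map Re cs). [:- c, 1:])"
    unfolding of_real_hom.char_poly_hom[OF carrier, symmetric] Re cs ..
  also have "\<dots> = map_poly complex_of_real (\<Prod>a\<leftarrow>map Re cs. [:- a, 1:])"
    by (simp add: map_poly_of_real.hom_prod_list o_def hom_distribs)
  finally have "char_poly B = (\<Prod>a\<leftarrow>map Re cs. [:- a, 1:])"
    by (rule map_poly_of_real.injectivity)
  then show ?thesis by blast
qed

section \<open>Diagonalization\<close>

text \<open>
  A nontrivial Jordan block would give vectors \<open>p \<noteq> 0\<close> and \<open>q\<close> with \<open>B p = a p\<close> and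
  \<open>B q = a q + p\<close>, whence \<open>p \<star> p = p \<star> (B q - a q) = (B p - a p) \<star> q = 0\<close>. The
  columns of \<open>P\<close> are the eigenvectors, and \<open>Q\<close> is the inverse of \<open>P\<close>.
\<close>

lemma eigenbasis:
  obtains P Q :: "nat \<Rightarrow> nat \<Rightarrow> real" and lam :: "nat \<Rightarrow> real"
  where "\<And>i j. i < n \<Longrightarrow> j < n \<Longrightarrow> (\<Sum>l<n. P i l * Q l j) = (if i = j then 1 else 0)"
    and "\<And>i j. i < n \<Longrightarrow> j < n \<Longrightarrow> mat_apply n B (\<lambda>i. P i j) i = lam j * P i j"
    and "char_poly B = (\<Prod>a\<leftarrow>map lam [0..<n]. [:- a, 1:])"
proof -
  obtain as where "char_poly B = (\<Prod>a\<leftarrow>as. [:- a, 1:])" using char_poly_splits by blast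
  then obtain n_as where "jordan_nf B n_as" using jordan_nf_exists[OF carrier] by blast
  then have sim: "similar_mat B (jordan_matrix n_as)" unfolding jordan_nf_def by simp
  define J where "J = jordan_matrix n_as"
  obtain P Q where wit: "similar_mat_wit B J P Q" using sim unfolding similar_mat_def J_def by blast
  note wit = similar_mat_witD2[OF carrier wit]
  have n: "sum_list (map fst n_as) = n"
    using wit(5) unfolding J_def by (metis carrier_matD(1) jordan_matrix_dim(1))
  note J_entry = jordan_matrix_nonzero_entry[of _ n_as, folded J_def, unfolded n]
  have BP: "B * P = P * J"
  proof -
    have "B * P = P * J * (Q * P)"
      unfolding wit(3) by (rule assoc_mult_mat) (use wit in auto)
    then show ?thesis using wit by simp
  qed
  have col: "mat_apply n B (\<lambda>i. P $$ (i, j)) i = (\<Sum>l<n. P $$ (i, l) * J $$ (l, j))"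
    if "i < n" "j < n" for i j
  proof -
    have "(B * P) $$ (i, j) = (P * J) $$ (i, j)" using BP by simp
    then show ?thesis
      using that wit carrier by (simp add: scalar_prod_def mat_apply_def lessThan_atLeast0)
  qed
  have inverse: "(\<Sum>l<n. X $$ (i, l) * Y $$ (l, j)) = (if i = j then 1 else 0)"
    if "X * Y = 1\<^sub>m n" "X \<in> carrier_mat n n" "Y \<in> carrier_mat n n" "i < n" "j < n" for X Y :: "real mat" and i j
  proof -
    have "(X * Y) $$ (i, j) = (if i = j then 1 else 0)" using that by simp
    then show ?thesis using that(2-) by (simp add: scalar_prod_def lessThan_atLeast0)
  qed
  \<comment> \<open>Strong induction on the column: a nonzero off-diagonal entry in column
    \<open>j\<close> sits in row \<open>i = j - 1\<close>, and column \<open>i\<close> is already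
    diagonal, so \<open>p i\<close> is a genuine eigenvector and \<open>p j\<close> continues its
    chain.\<close>
  have diag: "J $$ (i, j) = 0" if "i < n" "j < n" "i \<noteq> j" for i j
    using that
  proof (induction j arbitrary: i rule: less_induct)
    case (less j)
    show ?case
    proof (rule ccontr)
      assume ij: "J $$ (i, j) \<noteq> 0"
      then have j: "j = Suc i" "J $$ (i, j) = 1" "J $$ (i, i) = J $$ (j, j)"
        using J_entry less.prems by blast+
      define p where "p m = (\<lambda>r. P $$ (r, m))" for m
      have Bi: "mat_apply n B (p i) r = J $$ (j, j) * p i r" if "r < n" for r
      proof -
        have "mat_apply n B (p i) r = (\<Sum>l<n. P $$ (r, l) * J $$ (l, i))"
          unfolding p_def using col that less.prems by simp
        also have "\<dots> = (\<Sum>l\<in>{i}. P $$ (r, l) * J $$ (l, i))"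
          using less.IH[of i] less.prems j(1) by (intro sum.mono_neutral_right) auto
        finally show ?thesis using j by (simp add: p_def)
      qed
      have off: "J $$ (l, j) = 0" if "l < n" "l \<noteq> i" "l \<noteq> j" for l
        using J_entry[OF that(1) less.prems(2) _ that(3)] that(2) j(1) by blast
      \<comment> \<open>The factor \<open>1\<close> gives the sum the shape required by
        \<open>weighted_inner_add\<close>.\<close>
      have Bj: "mat_apply n B (p j) r = J $$ (j, j) * p j r + 1 * p i r" if "r < n" for r
      proof -
        have "mat_apply n B (p j) r = (\<Sum>l<n. P $$ (r, l) * J $$ (l, j))"
          unfolding p_def using col that less.prems by simp
        also have "\<dots> = (\<Sum>l\<in>{i, j}. P $$ (r, l) * J $$ (l, j))"
          using less.prems off by (intro sum.mono_neutral_right) auto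
        finally show ?thesis using j less.prems by (simp add: p_def)
      qed
      have "J $$ (j, j) * (p i \<star> p j) + 1 * (p i \<star> p i) = p i \<star> mat_apply n B (p j)"
        unfolding weighted_inner_add[symmetric] by (rule weighted_inner_cong) (simp_all add: Bj)
      also have "\<dots> = p j \<star> mat_apply n B (p i)"
        by (metis self_adjoint weighted_inner_commute)
      also have "\<dots> = p j \<star> (\<lambda>r. J $$ (j, j) * p i r)"
        by (rule weighted_inner_cong) (simp_all add: Bi)
      also have "\<dots> = J $$ (j, j) * (p i \<star> p j)"
        by (metis weighted_inner_scale weighted_inner_commute)
      finally have "p i \<star> p i = 0" by simp
      \<comment> \<open>A vanishing column \<open>i\<close> of \<open>P\<close> contradicts the
        diagonal entry \<open>1\<close> of \<open>Q * P\<close>.\<close>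
      then have "P $$ (l, i) = 0" if "l < n" for l using ip_self_eq_0[of "p i"] that by (simp add: p_def)
      then have "(\<Sum>l<n. Q $$ (i, l) * P $$ (l, i)) = 0" by simp
      then show False using inverse[OF wit(2)] wit less.prems by simp
    qed
  qed
  show ?thesis
  proof (rule that[of "\<lambda>i l. P $$ (i, l)" "\<lambda>l j. Q $$ (l, j)" "\<lambda>j. J $$ (j, j)"])
    show "(\<Sum>l<n. P $$ (i, l) * Q $$ (l, j)) = (if i = j then 1 else 0)" if "i < n" "j < n" for i j
      using inverse[OF wit(1)] wit that by simp
    show "mat_apply n B (\<lambda>i. P $$ (i, j)) i = J $$ (j, j) * P $$ (i, j)" if "i < n" "j < n" for i j
    proof -
      have "mat_apply n B (\<lambda>i. P $$ (i, j)) i = (\<Sum>l\<in>{j}. P $$ (i, l) * J $$ (l, j))"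
        unfolding col[OF that] using that diag by (intro sum.mono_neutral_right) auto
      then show ?thesis by simp
    qed
    have "char_poly B = char_poly J" using sim unfolding J_def by (rule char_poly_similar)
    also have "\<dots> = (\<Prod>a\<leftarrow>diag_mat J. [:- a, 1:])"
      by (rule char_poly_upper_triangular[OF wit(5)]) (use diag wit(5) in auto)
    also have "diag_mat J = map (\<lambda>j. J $$ (j, j)) [0..<n]" using wit(5) by (simp add: diag_mat_def)
    finally show "char_poly B = (\<Prod>a\<leftarrow>map (\<lambda>j. J $$ (j, j)) [0..<n]. [:- a, 1:])" .
  qed
qed

section \<open>The Rayleigh quotient on a hyperplane\<close>

text \<open>
  The hyperplane is spanned by all eigenvectors but one for the largest eigenvalue. Eigenvectors
  within an eigenspace need not be orthogonal; scaling the coefficients by \<open>sqrt (\<eta>\<^sub>2 - \<lambda>)\<close> exhibits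
  the difference of the two sides as a square \<open>y \<star> y\<close> without orthonormalization.
\<close>

lemma rayleigh_bound_on_hyperplane:
  assumes "2 \<le> n"
  obtains u :: "nat \<Rightarrow> real"
  where "\<And>h. (\<Sum>i<n. u i * h i) = 0 \<Longrightarrow> h \<star> mat_apply n B h \<le> nth_eigenvalue B 2 * (h \<star> h)"
proof -
  obtain P Q lam where
    PQ: "\<And>i j. i < n \<Longrightarrow> j < n \<Longrightarrow> (\<Sum>l<n. P i l * Q l j) = (if i = j then 1 else 0)"
    and ev: "\<And>i j. i < n \<Longrightarrow> j < n \<Longrightarrow> mat_apply n B (\<lambda>i. P i j) i = lam j * P i j"
    and cp: "char_poly B = (\<Prod>a\<leftarrow>map lam [0..<n]. [:- a, 1:])"
    using eigenbasis by blast
  define \<eta>2 where "\<eta>2 = nth_eigenvalue B 2"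
  obtain p where lam_le: "\<And>l. l < n \<Longrightarrow> l \<noteq> p \<Longrightarrow> lam l \<le> \<eta>2"
  proof -
    let ?L = "map lam [0..<n]" and ?E = "eigenvalues_decreasing B"
    have E: "?E = rev (sort ?L)"
      unfolding eigenvalues_decreasing_def cp proots_linear_factors sorted_list_of_multiset_mset ..
    then have "mset ?L = mset ?E" by simp
    then obtain f where f: "bij_betw f {..<length ?L} {..<length ?E}"
      "\<And>l. l < length ?L \<Longrightarrow> ?L ! l = ?E ! f l"
      using permutation_Ex_bij by blast
    \<comment> \<open>\<open>p\<close> is the index matched with the head of the decreasing list.
      All others have positions at least \<open>1\<close>, and the zero-based entry \<open>1\<close>
      is \<open>nth_eigenvalue B 2\<close>.\<close>
    define p where "p = inv_into {..<n} f 0"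
    show thesis
    proof (rule that[of p])
      fix l assume l: "l < n" "l \<noteq> p"
      have inj: "inj_on f {..<n}" using f(1) by (simp add: bij_betw_def)
      have "f l \<noteq> 0"
      proof
        assume "f l = 0"
        then have "p = l" using inv_into_f_f[OF inj, of l] l(1) unfolding p_def by simp
        then show False using l(2) by simp
      qed
      moreover have "f l < n" using f(1) l(1) E by (auto simp: bij_betw_def)
      ultimately have "?E ! f l \<le> ?E ! 1"
        unfolding E by (intro sorted_rev_nth_mono) auto
      then show "lam l \<le> \<eta>2" using f(2)[of l] l(1) unfolding \<eta>2_def nth_eigenvalue_def by simp
    qed
  qed
  show thesis
  \<comment> \<open>Row \<open>p\<close> of \<open>Q\<close> reads off the coordinate along the
    omitted eigenvector, so the constraint becomes \<open>c p = 0\<close>.\<close>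
  proof (rule that[of "Q p"])
    fix h assume h: "(\<Sum>i<n. Q p i * h i) = 0"
    define c where "c l = (\<Sum>i<n. Q l i * h i)" for l
    have expand: "h i = (\<Sum>l<n. c l * P i l)" if i: "i < n" for i
    proof -
      have "(\<Sum>l<n. c l * P i l) = (\<Sum>l<n. \<Sum>j<n. (P i l * Q l j) * h j)"
        unfolding c_def by (simp add: sum_distrib_left algebra_simps)
      also have "\<dots> = (\<Sum>j<n. (\<Sum>l<n. P i l * Q l j) * h j)"
        by (subst sum.swap) (simp add: sum_distrib_right)
      also have "\<dots> = (\<Sum>j<n. if i = j then h j else 0)"
        using PQ i by (intro sum.cong refl) auto
      finally show ?thesis using i by simp
    qed
    have apply_expand: "mat_apply n B h i = (\<Sum>l<n. (c l * lam l) * P i l)" if i: "i < n" for i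
    proof -
      have "mat_apply n B h i = (\<Sum>j<n. \<Sum>l<n. c l * (B $$ (i, j) * P j l))"
        unfolding mat_apply_def by (simp add: expand sum_distrib_left algebra_simps)
      also have "\<dots> = (\<Sum>l<n. c l * mat_apply n B (\<lambda>i. P i l) i)"
        unfolding mat_apply_def by (subst sum.swap) (simp add: sum_distrib_left)
      finally show ?thesis using ev i by (simp add: algebra_simps)
    qed
    define G where "G j l = (\<lambda>i. P i j) \<star> (\<lambda>i. P i l)" for j l
    have G_orth: "lam j = lam l \<or> G j l = 0" if "j < n" "l < n" for j l
    proof -
      have "lam j * G j l = mat_apply n B (\<lambda>i. P i j) \<star> (\<lambda>i. P i l)"
        unfolding G_def using ev that
        by (subst (1 2) weighted_inner_commute, subst weighted_inner_scale[symmetric])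
           (intro weighted_inner_cong, auto)
      also have "\<dots> = (\<lambda>i. P i j) \<star> mat_apply n B (\<lambda>i. P i l)" by (rule self_adjoint)
      also have "\<dots> = lam l * G j l"
        unfolding G_def weighted_inner_scale[symmetric] using ev that by (intro weighted_inner_cong) auto
      finally show ?thesis by auto
    qed
    \<comment> \<open>For \<open>l \<noteq> p\<close> the radicand is nonnegative. At
      \<open>p\<close> it may be negative, and then \<open>s p * s p\<close> differs from it; this
      is harmless because \<open>c p = 0\<close>.\<close>
    define s where "s l = sqrt (\<eta>2 - lam l)" for l
    have "h \<star> (\<lambda>i. \<eta>2 * h i + (-1) * mat_apply n B h i)
        = (\<lambda>i. \<Sum>l<n. c l * P i l) \<star> (\<lambda>i. \<Sum>l<n. (c l * (\<eta>2 - lam l)) * P i l)"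
      by (intro weighted_inner_cong)
         (simp_all add: apply_expand, simp_all add: expand sum_distrib_left sum_subtractf[symmetric] algebra_simps)
    also have "\<dots> = (\<Sum>j<n. \<Sum>l<n. c j * (c l * (\<eta>2 - lam l)) * G j l)"
      unfolding weighted_inner_sum G_def ..
    also have "\<dots> = (\<Sum>j<n. \<Sum>l<n. (c j * s j) * (c l * s l) * G j l)"
    proof (intro sum.cong refl)
      fix j l assume "j \<in> {..<n}" "l \<in> {..<n}"
      moreover have "c p = 0" using h by (simp add: c_def)
      \<comment> \<open>Where \<open>G j l\<close> is nonzero, \<open>lam j = lam l\<close>, so the
        factor \<open>\<eta>2 - lam l\<close> can be shared as \<open>s j * s l\<close>.\<close>
      ultimately have "l = p \<and> c l = 0 \<or> G j l = 0 \<or> s j = s l \<and> s l * s l = \<eta>2 - lam l"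
        using G_orth[of j l] lam_le[of l] by (cases "l = p") (auto simp: s_def)
      then show "c j * (c l * (\<eta>2 - lam l)) * G j l = (c j * s j) * (c l * s l) * G j l"
        by (auto simp: algebra_simps)
    qed
    also have "\<dots> = (\<lambda>i. \<Sum>l<n. (c l * s l) * P i l) \<star> (\<lambda>i. \<Sum>l<n. (c l * s l) * P i l)"
      unfolding weighted_inner_sum G_def ..
    also have "\<dots> \<ge> 0" by (rule ip_self_nonneg)
    finally show "h \<star> mat_apply n B h \<le> nth_eigenvalue B 2 * (h \<star> h)"
      unfolding weighted_inner_add \<eta>2_def by simp
  qed
qed

end

section \<open>The Dirichlet form of a weighted graph\<close>

context weighted_graph
begin

abbreviation ew where "ew \<equiv> edge_weight E w"
abbreviation deg where "deg \<equiv> weighted_degree n E w"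
abbreviation "N \<equiv> normalized_adjacency_matrix n E w \<mu>"
definition dirichlet :: "(nat \<Rightarrow> real) \<Rightarrow> real" where
  "dirichlet f = (\<Sum>i<n. \<Sum>j<n. ew i j * (f i - f j)\<^sup>2) / 2"

lemma ew_commute: "ew i j = ew j i"
  unfolding edge_weight_def by (simp add: insert_commute)

lemma ew_nonneg: "0 \<le> ew i j"
  unfolding edge_weight_def using weight_pos by (simp add: less_imp_le)

lemma deg_eq_sum: "deg i = (\<Sum>j<n. ew i j)"
proof -
  have "{j. j < n \<and> {i, j} \<in> E} = {j \<in> {..<n}. {i, j} \<in> E}" by auto
  then show ?thesis unfolding weighted_degree_def edge_weight_def by (simp only: sum.inter_filter finite_lessThan)
qed

lemma N_entry: "i < n \<Longrightarrow> j < n \<Longrightarrow> N $$ (i, j) = ew i j / \<mu> i"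
  unfolding normalized_adjacency_matrix_def adjacency_matrix_def
  by (subst mat_diag_mult_left[of _ n n]) auto

text \<open>Multiplying row \<open>i\<close> of \<open>N\<close> by \<open>\<mu> i\<close> restores
  the symmetric weight \<open>ew i j\<close>.\<close>

sublocale N: weighted_self_adjoint n \<mu> N
proof
  show "N \<in> carrier_mat n n"
    unfolding normalized_adjacency_matrix_def adjacency_matrix_def by (rule mult_carrier_mat[of _ n n]) auto
  show "\<mu> i * N $$ (i, j) = \<mu> j * N $$ (j, i)" if "i < n" "j < n" for i j
    using that measure_pos[of i] measure_pos[of j] by (simp add: N_entry ew_commute[of i j])
qed (rule measure_pos)

text \<open>Expanding the square gives the degree term twice, by symmetry of \<open>ew\<close>; in
  the inner product \<open>\<mu> i\<close> cancels the denominator in \<open>N\<close>.\<close>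

lemma dirichlet_eq: "dirichlet f = (\<Sum>i<n. deg i * (f i)\<^sup>2) - f \<star> mat_apply n N f"
proof -
  let ?D = "\<Sum>i<n. \<Sum>j<n. ew i j * (f i)\<^sup>2" and ?A = "\<Sum>i<n. \<Sum>j<n. ew i j * (f i * f j)"
  have "(\<Sum>i<n. \<Sum>j<n. ew i j * (f j)\<^sup>2) = ?D"
    by (subst sum.swap) (simp add: ew_commute)
  moreover have "(\<Sum>i<n. \<Sum>j<n. ew i j * (f i - f j)\<^sup>2)
      = ?D + (\<Sum>i<n. \<Sum>j<n. ew i j * (f j)\<^sup>2) - 2 * ?A"
    unfolding sum_distrib_left sum.distrib[symmetric] sum_subtractf[symmetric]
    by (intro sum.cong refl) (simp add: power2_diff algebra_simps)
  ultimately have "dirichlet f = ?D - ?A" unfolding dirichlet_def by simp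
  moreover have "?D = (\<Sum>i<n. deg i * (f i)\<^sup>2)"
    unfolding deg_eq_sum by (simp add: sum_distrib_right)
  moreover have "f \<star> mat_apply n N f = ?A"
    unfolding weighted_inner_def mat_apply_def sum_distrib_left
    using measure_pos by (intro sum.cong refl) (fastforce simp: N_entry)
  ultimately show ?thesis by simp
qed

lemma dirichlet_shift: "dirichlet (\<lambda>i. a + f i) = dirichlet f"
  unfolding dirichlet_def by simp

text \<open>Only pairs with exactly one end in \<open>S\<close> contribute; each boundary edge
  occurs in both orders, which cancels the half.\<close>

lemma dirichlet_indicator:
  assumes "S \<subseteq> {..<n}"
  shows "dirichlet (\<lambda>i. of_bool (i \<in> S)) = (\<Sum>i\<in>S. \<Sum>j\<in>{..<n} - S. ew i j)"
proof -
  let ?T = "{..<n} - S"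
  have split: "(\<Sum>i<n. g i) = (\<Sum>i\<in>S. g i) + (\<Sum>i\<in>?T. g i)" for g :: "nat \<Rightarrow> real"
    using sum.subset_diff[OF assms finite_lessThan, of g] by simp
  have "(\<Sum>i\<in>?T. \<Sum>j\<in>S. ew i j) = (\<Sum>i\<in>S. \<Sum>j\<in>?T. ew i j)"
    by (subst sum.swap) (simp add: ew_commute)
  then show ?thesis
    unfolding dirichlet_def split by (simp add: sum.distrib)
qed

lemma tau_min_le: "i < n \<Longrightarrow> tau_min n E w \<mu> * \<mu> i \<le> deg i"
proof -
  assume i: "i < n"
  then have "tau_min n E w \<mu> \<le> deg i / \<mu> i"
    unfolding tau_min_def by (intro Min_le) auto
  then show ?thesis using measure_pos[OF i] by (simp add: pos_le_divide_eq)
qed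

section \<open>Poincare inequality and lower bounds for \<open>Phi\<close>\<close>

text \<open>
  Weyl's inequality in disguise: on the hyperplane where the Rayleigh quotient of \<open>N\<close> is at most
  \<open>\<eta>\<^sub>2\<close>, the Dirichlet form is at least \<open>\<tau>\<^sub>m\<^sub>i\<^sub>n - \<eta>\<^sub>2 > 0\<close> times the squared norm. It vanishes on
  constants, so the hyperplane contains no nonzero constant, and every \<open>f\<close> can be moved into it
  by adding a constant.
\<close>

lemma poincare_inequality:
  assumes n: "2 \<le> n" and gap: "nth_eigenvalue N 2 < tau_min n E w \<mu>"
  shows "(tau_min n E w \<mu> - nth_eigenvalue N 2) * (f \<star> f - (\<Sum>i<n. \<mu> i * f i)\<^sup>2 / (\<Sum>i<n. \<mu> i))
    \<le> dirichlet f"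
proof -
  define \<delta> where "\<delta> = tau_min n E w \<mu> - nth_eigenvalue N 2"
  have "\<delta> > 0" using gap by (simp add: \<delta>_def)
  define m where "m = (\<Sum>i<n. \<mu> i)"
  have "m > 0" unfolding m_def using n measure_pos by (intro sum_pos) (auto simp: lessThan_empty_iff)
  obtain u where u: "\<And>h. (\<Sum>i<n. u i * h i) = 0 \<Longrightarrow> h \<star> mat_apply n N h \<le> nth_eigenvalue N 2 * (h \<star> h)"
    using N.rayleigh_bound_on_hyperplane[OF n] by blast
  have bound: "\<delta> * (h \<star> h) \<le> dirichlet h" if h: "(\<Sum>i<n. u i * h i) = 0" for h
  proof -
    have "tau_min n E w \<mu> * (h \<star> h) = (\<Sum>i<n. (tau_min n E w \<mu> * \<mu> i) * (h i)\<^sup>2)"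
      unfolding weighted_inner_def by (simp add: sum_distrib_left power2_eq_square algebra_simps)
    also have "\<dots> \<le> (\<Sum>i<n. deg i * (h i)\<^sup>2)"
      using tau_min_le by (intro sum_mono mult_right_mono) auto
    finally show ?thesis using u[OF h] unfolding dirichlet_eq \<delta>_def by (simp add: algebra_simps)
  qed
  have u1: "(\<Sum>i<n. u i) \<noteq> 0"
  proof
    assume "(\<Sum>i<n. u i) = 0"
    then have "\<delta> * m \<le> 0"
      using bound[of "\<lambda>_. 1"] by (simp add: dirichlet_def weighted_inner_def m_def)
    then show False using \<open>\<delta> > 0\<close> \<open>m > 0\<close> by (simp add: mult_le_0_iff)
  qed
  define a where "a = - (\<Sum>i<n. u i * f i) / (\<Sum>i<n. u i)"
  define s where "s = (\<Sum>i<n. \<mu> i * f i)"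
  let ?h = "\<lambda>i. a + f i"
  have "(\<Sum>i<n. u i * ?h i) = a * (\<Sum>i<n. u i) + (\<Sum>i<n. u i * f i)"
    by (simp add: algebra_simps sum.distrib sum_distrib_left)
  also have "\<dots> = 0" using u1 by (simp add: a_def)
  finally have "\<delta> * (?h \<star> ?h) \<le> dirichlet f"
    using bound[of ?h] unfolding dirichlet_shift by blast
  \<comment> \<open>Completing the square: the left side is the least squared norm of
    \<open>f\<close> plus a constant, attained at \<open>- s / m\<close>, so the particular shift
    \<open>a\<close> drops out.\<close>
  moreover have "f \<star> f - s\<^sup>2 / m \<le> ?h \<star> ?h"
  proof -
    have "?h \<star> ?h = a\<^sup>2 * m + 2 * a * s + f \<star> f"
      unfolding weighted_inner_def m_def s_def
      by (simp add: algebra_simps sum.distrib sum_distrib_left power2_eq_square)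
    also have "\<dots> = m * (a + s / m)\<^sup>2 + (f \<star> f - s\<^sup>2 / m)"
      using \<open>m > 0\<close> by (simp add: field_simps power2_eq_square)
    finally show ?thesis using \<open>m > 0\<close> by simp
  qed
  ultimately show ?thesis
    unfolding \<delta>_def[symmetric] m_def[symmetric] s_def[symmetric]
    using \<open>\<delta> > 0\<close> by (meson less_imp_le mult_left_mono order_trans)
qed

text \<open>For an indicator, the squared norm and the weighted sum both equal the measure of
  \<open>S\<close>; dividing the Poincare inequality by it gives the claim.\<close>

lemma Phi_lower_bound:
  assumes "2 \<le> n" "nth_eigenvalue N 2 < tau_min n E w \<mu>" and S: "S \<subseteq> {..<n}" "S \<noteq> {}"
  shows "(tau_min n E w \<mu> - nth_eigenvalue N 2) * (1 - (\<Sum>i\<in>S. \<mu> i) / (\<Sum>i<n. \<mu> i)) \<le> Phi n E w \<mu> S"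
proof -
  have ind: "(\<Sum>i<n. \<mu> i * of_bool (i \<in> S)) = (\<Sum>i\<in>S. \<mu> i)"
    using S(1) by (simp add: of_bool_def if_distrib sum.inter_restrict[symmetric] Int_absorb1 cong: if_cong)
  then have "(\<lambda>i. of_bool (i \<in> S)) \<star> (\<lambda>i. of_bool (i \<in> S)) = (\<Sum>i\<in>S. \<mu> i)"
    unfolding weighted_inner_def by (simp add: mult.assoc of_bool_conj[symmetric])
  moreover have "(\<Sum>i\<in>S. \<mu> i) > 0"
    using S measure_pos finite_subset[OF S(1)] by (intro sum_pos) auto
  moreover have "m - m\<^sup>2 / v = (1 - m / v) * m" for m v :: real
    by (simp add: power2_eq_square algebra_simps)
  ultimately show ?thesis
    using poincare_inequality[OF assms(1,2), of "\<lambda>i. of_bool (i \<in> S)"]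
    unfolding dirichlet_indicator[OF S(1)] Phi_def ind by (simp add: pos_le_divide_eq mult.assoc)
qed

lemma Phi_nonneg: "S \<subseteq> {..<n} \<Longrightarrow> 0 \<le> Phi n E w \<mu> S"
  unfolding Phi_def
  using ew_nonneg measure_pos by (intro divide_nonneg_nonneg sum_nonneg) (auto simp: less_imp_le)

section \<open>Disjoint tuples of vertex sets\<close>

text \<open>Averaging: if every part had more than a \<open>1 / k\<close> share, the disjoint parts
  would together outweigh the vertex set.\<close>

lemma disjoint_tuple_small_part:
  assumes A: "A \<in> disjoint_tuples n k" and "1 \<le> k"
  obtains i where "i \<in> {1..k}" "real k * (\<Sum>j\<in>A i. \<mu> j) \<le> (\<Sum>j<n. \<mu> j)"
proof (rule ccontr)
  assume "\<not> thesis"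
  then have big: "(\<Sum>j<n. \<mu> j) / real k < (\<Sum>j\<in>A i. \<mu> j)" if "i \<in> {1..k}" for i
  proof -
    have "\<not> real k * (\<Sum>j\<in>A i. \<mu> j) \<le> (\<Sum>j<n. \<mu> j)"
      using \<open>\<not> thesis\<close> \<open>\<And>i. i \<in> {1..k} \<Longrightarrow> real k * (\<Sum>j\<in>A i. \<mu> j) \<le> (\<Sum>j<n. \<mu> j) \<Longrightarrow> thesis\<close> that
      by blast
    then show ?thesis using assms(2) by (simp add: divide_less_eq mult.commute)
  qed
  have sub: "A i \<subseteq> {..<n}" if "i \<in> {1..k}" for i
    using A that unfolding disjoint_tuples_def by auto
  have disj: "disjoint_family_on A {1..k}" using A unfolding disjoint_tuples_def by simp
  have "(\<Sum>j<n. \<mu> j) = (\<Sum>i\<in>{1..k}. (\<Sum>j<n. \<mu> j) / real k)" using assms(2) by simp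
  also have "\<dots> < (\<Sum>i\<in>{1..k}. \<Sum>j\<in>A i. \<mu> j)"
    using big assms(2) by (intro sum_strict_mono) auto
  also have "\<dots> = (\<Sum>j\<in>(\<Union>i\<in>{1..k}. A i). \<mu> j)"
    using disj finite_subset[OF sub finite_lessThan]
    by (intro sum.UNION_disjoint[symmetric]) (auto simp: disjoint_family_on_def)
  also have "\<dots> \<le> (\<Sum>j<n. \<mu> j)"
    using sub measure_pos by (intro sum_mono2) (auto simp: less_imp_le subset_iff)
  finally show False by simp
qed

text \<open>Together with \<open>disjoint_tuples_nonempty\<close>, lets a bound valid for every
  tuple pass to the \<open>MIN\<close> in \<open>rho\<close>.\<close>

lemma finite_disjoint_tuples: "finite (disjoint_tuples n k)"
  unfolding disjoint_tuples_def
  by (rule finite_subset[OF _ finite_PiE[of "{1..k}" "\<lambda>_. Pow {..<n} - {{}}"]]) auto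

lemma disjoint_tuples_nonempty:
  assumes "k \<le> n"
  shows "disjoint_tuples n k \<noteq> {}"
proof -
  \<comment> \<open>Tuples are indexed from 1 and vertices from 0, hence
    \<open>i - 1\<close>.\<close>
  have "(\<lambda>i\<in>{1..k}. {i - 1}) \<in> disjoint_tuples n k"
    using assms unfolding disjoint_tuples_def disjoint_family_on_def by auto
  then show ?thesis by blast
qed

end

theorem theorem5p1:
  fixes n k :: nat
    and E :: "nat set set"
    and w :: "nat set \<Rightarrow> real"
    and \<mu> :: "nat \<Rightarrow> real"
  assumes "weighted_graph n E w \<mu>"
    and "n \<ge> 3"
    and "1 \<le> k" and "k \<le> n"
  shows "rho n E w \<mu> k \<ge> (tau_min n E w \<mu> - eta n E w \<mu>) * (1 - 1 / real k)"
proof -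
  interpret weighted_graph n E w \<mu> by (rule assms(1))
  let ?\<tau> = "tau_min n E w \<mu>" and ?\<eta> = "eta n E w \<mu>" and ?\<eta>2 = "nth_eigenvalue N 2"
  have k: "0 \<le> 1 - 1 / real k" using assms(3) by simp
  have "(?\<tau> - ?\<eta>) * (1 - 1 / real k) \<le> (MAX i\<in>{1..k}. Phi n E w \<mu> (A i))"
    if A: "A \<in> disjoint_tuples n k" for A
  proof -
    have part: "A i \<subseteq> {..<n}" "A i \<noteq> {}" if "i \<in> {1..k}" for i
      using A that unfolding disjoint_tuples_def by auto
    obtain i where i: "i \<in> {1..k}" "real k * (\<Sum>j\<in>A i. \<mu> j) \<le> (\<Sum>j<n. \<mu> j)"
      using disjoint_tuple_small_part[OF A assms(3)] by blast
    have "(?\<tau> - ?\<eta>) * (1 - 1 / real k) \<le> Phi n E w \<mu> (A i)"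
    proof (cases "?\<eta> < ?\<tau>")
      case True
      have le: "?\<eta>2 \<le> ?\<eta>" unfolding eta_def by simp
      have "(\<Sum>j<n. \<mu> j) > 0" using assms(2) measure_pos by (intro sum_pos) (auto simp: lessThan_empty_iff)
      then have "(\<Sum>j\<in>A i. \<mu> j) / (\<Sum>j<n. \<mu> j) \<le> 1 / real k"
        using i(2) assms(3) by (simp add: field_simps)
      \<comment> \<open>Both factors grow: the first since \<open>?\<eta>2 \<le> ?\<eta>\<close>,
        the second since \<open>A i\<close> has at most a \<open>1 / k\<close> share of the
        measure.\<close>
      then have "(?\<tau> - ?\<eta>) * (1 - 1 / real k)
          \<le> (?\<tau> - ?\<eta>2) * (1 - (\<Sum>j\<in>A i. \<mu> j) / (\<Sum>j<n. \<mu> j))"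
        using True le k by (intro mult_mono) auto
      also have "\<dots> \<le> Phi n E w \<mu> (A i)"
        using Phi_lower_bound[OF _ _ part[OF i(1)]] assms(2) True le by simp
      finally show ?thesis .
    next
      case False
      then have "(?\<tau> - ?\<eta>) * (1 - 1 / real k) \<le> 0" using k by (intro mult_nonpos_nonneg) auto
      then show ?thesis using Phi_nonneg[OF part(1)[OF i(1)]] by simp
    qed
    also have "\<dots> \<le> (MAX i\<in>{1..k}. Phi n E w \<mu> (A i))" using i(1) by (intro Max_ge) auto
    finally show ?thesis .
  qed
  then show ?thesis
    unfolding rho_def
    using finite_disjoint_tuples disjoint_tuples_nonempty[OF assms(4)] by simp
qed

end
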